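(* Let $\mathfrak{A}$ be a $C^*$-algebra and let $H,K$ be Hilbert $\mathfrak{A}$-modules. Let $T\in\mathcal{L}(H,K)$ be such that $\overline{\mathcal{R}(T^* )}$ is orthogonally complemented in $H$, and let $U\in\mathcal{L}(H,K)$ be a partial isometry such that $$T=U|T|\quad\text{and}\quad U^*U=P_{\overline{\mathcal{R}(T^* )}}.$$ Then $\overline{\mathcal{R}(T)}$ is also orthogonally complemented (in $K$), and the following equations hold: $$\mathcal{N}(U)=\mathcal{N}(T),\quad \mathcal{N}(U^* )=\mathcal{N}(T^* ),\quad \mathcal{R}(U)=\overline{\mathcal{R}(T)},\quad \mathcal{R}(U^* )=\overline{\mathcal{R}(T^* )}.$$ Furthermore, the following equations are also valid: $$T^*=U^*|T^*|\quad\text{and}\quad UU^*=P_{\overline{\mathcal{R}(T)}},$$ $$|T^*|=U|T|U^*\quad\text{and}\quad U|T|=|T^*|U.$$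
   Context: $\mathcal{L}(H,K)$ denotes the set of adjointable operators from $H$ to $K$, i.e. maps $T:H\to K$ for which there is $T^*:K\to H$ with $\langle Tx,y\rangle=\langle x,T^*y\rangle$ for all $x\in H$, $y\in K$. $\mathcal{R}(T)$ and $\mathcal{N}(T)$ are the range and null space of $T$; the bar denotes norm closure. A closed submodule $M$ of a Hilbert $\mathfrak{A}$-module $E$ is orthogonally complemented if $E=M\dotplus M^\perp$, where $M^\perp=\{x\in E:\langle x,y\rangle=0 \text{ for all } y\in M\}$; in that case $P_M$ denotes the projection from $E$ onto $M$ along $M^\perp$. An operator $U\in\mathcal{L}(H,K)$ is a partial isometry if $U^*U$ is a projection in $\mathcal{L}(H)$. For $T\in\mathcal{L}(H,K)$, $|T|=(T^*T)^{1/2}$ and $|T^*|=(TT^* )^{1/2}$. *)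

theory Defs
  imports "HOL-Analysis.Analysis"
begin

section \<open>Complex Banach spaces and C*-algebras\<close>

class complex_banach = banach +
  fixes scaleC :: "complex \<Rightarrow> 'a \<Rightarrow> 'a"
  assumes scaleC_add_right: "scaleC c (x + y) = scaleC c x + scaleC c y"
    and scaleC_add_left: "scaleC (c + d) x = scaleC c x + scaleC d x"
    and scaleC_scaleC: "scaleC c (scaleC d x) = scaleC (c * d) x"
    and scaleR_eq_scaleC: "scaleR r x = scaleC (complex_of_real r) x"
    and norm_scaleC: "norm (scaleC c x) = cmod c * norm x"

text \<open>The algebra is not assumed to be unital.\<close>

class cstar_algebra = complex_banach + real_normed_algebra +
  fixes star :: "'a \<Rightarrow> 'a"
  assumes mult_scaleC_left: "scaleC c x * y = scaleC c (x * y)"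
    and mult_scaleC_right: "x * scaleC c y = scaleC c (x * y)"
    and star_add: "star (x + y) = star x + star y"
    and star_scaleC: "star (scaleC c x) = scaleC (cnj c) (star x)"
    and star_mult: "star (x * y) = star y * star x"
    and star_star: "star (star x) = x"
    and cstar_identity: "norm (star x * x) = (norm x)\<^sup>2"

definition cstar_positive :: "'a::cstar_algebra \<Rightarrow> bool" where
  "cstar_positive a \<longleftrightarrow> (\<exists>b. a = star b * b)"

section \<open>Hilbert C*-modules\<close>

text \<open>
  Right modules, with inner product linear in the second variable. The norm of the underlying
  Banach space is required to be the one induced by the inner product, so closures and
  completeness are those of the Hilbert module.
\<close>

locale hilbert_module =
  fixes inn :: "'h::complex_banach \<Rightarrow> 'h \<Rightarrow> 'a::cstar_algebra"
    and act :: "'h \<Rightarrow> 'a \<Rightarrow> 'h"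
  assumes act_add_left: "act (x + y) a = act x a + act y a"
    and act_add_right: "act x (a + b) = act x a + act x b"
    and act_mult: "act x (a * b) = act (act x a) b"
    and act_scaleC_left: "act (scaleC c x) a = scaleC c (act x a)"
    and act_scaleC_right: "act x (scaleC c a) = scaleC c (act x a)"
    and inn_add_right: "inn x (y + z) = inn x y + inn x z"
    and inn_scaleC_right: "inn x (scaleC c y) = scaleC c (inn x y)"
    and inn_act_right: "inn x (act y a) = inn x y * a"
    and inn_star: "inn y x = star (inn x y)"
    and inn_positive: "cstar_positive (inn x x)"
    and inn_definite: "inn x x = 0 \<longleftrightarrow> x = 0"
    and norm_eq_sqrt_inn: "norm x = sqrt (norm (inn x x))"

definition is_submodule :: "('h::complex_banach \<Rightarrow> 'a \<Rightarrow> 'h) \<Rightarrow> 'h set \<Rightarrow> bool" where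
  "is_submodule act M \<longleftrightarrow> 0 \<in> M \<and> (\<forall>x\<in>M. \<forall>y\<in>M. x + y \<in> M)
     \<and> (\<forall>c. \<forall>x\<in>M. scaleC c x \<in> M) \<and> (\<forall>x\<in>M. \<forall>a. act x a \<in> M)"

definition orth_compl :: "('h \<Rightarrow> 'h \<Rightarrow> 'a::zero) \<Rightarrow> 'h set \<Rightarrow> 'h set" where
  "orth_compl inn M = {x. \<forall>y\<in>M. inn x y = 0}"

definition orth_complemented ::
    "('h::complex_banach \<Rightarrow> 'h \<Rightarrow> 'a::cstar_algebra) \<Rightarrow> ('h \<Rightarrow> 'a \<Rightarrow> 'h) \<Rightarrow> 'h set \<Rightarrow> bool" where
  "orth_complemented inn act M \<longleftrightarrow> closed M \<and> is_submodule act M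
     \<and> {m + n | m n. m \<in> M \<and> n \<in> orth_compl inn M} = UNIV
     \<and> M \<inter> orth_compl inn M = {0}"

text \<open>Meaningful only for orthogonally complemented \<open>M\<close>.\<close>

definition orth_proj :: "('h::complex_banach \<Rightarrow> 'h \<Rightarrow> 'a::cstar_algebra) \<Rightarrow> 'h set \<Rightarrow> 'h \<Rightarrow> 'h" where
  "orth_proj inn M x = (THE m. m \<in> M \<and> x - m \<in> orth_compl inn M)"

section \<open>Adjointable operators\<close>

definition is_adjoint ::
    "('h \<Rightarrow> 'h \<Rightarrow> 'a) \<Rightarrow> ('k \<Rightarrow> 'k \<Rightarrow> 'a) \<Rightarrow> ('h \<Rightarrow> 'k) \<Rightarrow> ('k \<Rightarrow> 'h) \<Rightarrow> bool" where
  "is_adjoint innH innK T S \<longleftrightarrow> (\<forall>x y. innK (T x) y = innH x (S y))"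

definition adjointable ::
    "('h \<Rightarrow> 'h \<Rightarrow> 'a) \<Rightarrow> ('k \<Rightarrow> 'k \<Rightarrow> 'a) \<Rightarrow> ('h \<Rightarrow> 'k) set" where
  "adjointable innH innK = {T. \<exists>S. is_adjoint innH innK T S}"

definition adj ::
    "('h \<Rightarrow> 'h \<Rightarrow> 'a) \<Rightarrow> ('k \<Rightarrow> 'k \<Rightarrow> 'a) \<Rightarrow> ('h \<Rightarrow> 'k) \<Rightarrow> 'k \<Rightarrow> 'h" where
  "adj innH innK T = (THE S. is_adjoint innH innK T S)"

definition null_space :: "('h \<Rightarrow> 'k::zero) \<Rightarrow> 'h set" where
  "null_space T = {x. T x = 0}"

definition is_projection :: "('h \<Rightarrow> 'h \<Rightarrow> 'a) \<Rightarrow> ('h \<Rightarrow> 'h) \<Rightarrow> bool" where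
  "is_projection inn P \<longleftrightarrow> P \<in> adjointable inn inn \<and> adj inn inn P = P \<and> P \<circ> P = P"

definition partial_isometry ::
    "('h \<Rightarrow> 'h \<Rightarrow> 'a) \<Rightarrow> ('k \<Rightarrow> 'k \<Rightarrow> 'a) \<Rightarrow> ('h \<Rightarrow> 'k) \<Rightarrow> bool" where
  "partial_isometry innH innK U \<longleftrightarrow>
     U \<in> adjointable innH innK \<and> is_projection innH (adj innH innK U \<circ> U)"

text \<open>
  Positivity and square roots of operators are those of the C*-algebra of adjointable operators
  on the module.
\<close>

definition positive_operator :: "('h \<Rightarrow> 'h \<Rightarrow> 'a) \<Rightarrow> ('h \<Rightarrow> 'h) \<Rightarrow> bool" where
  "positive_operator inn S \<longleftrightarrow> (\<exists>R \<in> adjointable inn inn. S = adj inn inn R \<circ> R)"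

definition operator_sqrt :: "('h \<Rightarrow> 'h \<Rightarrow> 'a) \<Rightarrow> ('h \<Rightarrow> 'h) \<Rightarrow> 'h \<Rightarrow> 'h" where
  "operator_sqrt inn S = (THE R. positive_operator inn R \<and> R \<circ> R = S)"

definition operator_abs ::
    "('h \<Rightarrow> 'h \<Rightarrow> 'a) \<Rightarrow> ('k \<Rightarrow> 'k \<Rightarrow> 'a) \<Rightarrow> ('h \<Rightarrow> 'k) \<Rightarrow> 'h \<Rightarrow> 'h" where
  "operator_abs innH innK T = operator_sqrt innH (adj innH innK T \<circ> T)"

end

theory Submission
  imports Defs
begin

text \<open>
  The substance of the theorem is that \<open>|T|\<close> exists and is unique, so that it is characterized by
  positivity and \<open>|T|\<^sup>2 = T\<^sup>*T\<close>. Call a selfadjoint \<open>A\<close> positive if \<open>\<parallel>t - A\<parallel> \<le> t\<close> for some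
  \<open>t > 0\<close>. Such operators have square roots, limits of polynomials, and these are unique because
  commuting selfadjoint \<open>X\<close>, \<open>Y\<close> with \<open>X\<^sup>2 + Y\<^sup>2 = 0\<close> vanish. Squares of selfadjoint operators are
  positive, and so is \<open>T\<^sup>*T\<close>: its negative part would yield \<open>C\<close> and a selfadjoint \<open>E\<close> with
  \<open>C\<^sup>*C = - E\<^sup>2\<close>. Over one and the same module this forces \<open>C = 0\<close>; applied to the algebra as a
  module over itself, it shows that a sum of positive elements vanishes only trivially, which settles
  the general case through the inner product.

  Given this, \<open>U|T|U\<^sup>*\<close> is positive with square \<open>TT\<^sup>*\<close>, hence equals \<open>|T\<^sup>*|\<close>, and \<open>UU\<^sup>*\<close> is the
  projection onto the closed range of \<open>U\<close>, in which the range of \<open>T\<close> is dense.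
\<close>

section \<open>Inner products and adjointable operators\<close>

lemma scaleC_zero_left [simp]: "scaleC 0 (x::'a::complex_banach) = 0"
  by (metis of_real_0 scaleR_eq_scaleC scaleR_zero_left)

lemma scaleC_zero_right [simp]: "scaleC c (0::'a::complex_banach) = 0"
  by (metis add_cancel_right_right scaleC_add_right)

lemma scaleC_minus_one: "scaleC (-1) (x::'a::complex_banach) = - x"
  by (metis of_real_1 of_real_minus scaleR_eq_scaleC scaleR_minus1_left)

lemma scaleC_minus_right: "scaleC c (- x) = - scaleC c (x::'a::complex_banach)"
  by (metis add.right_inverse minus_unique scaleC_add_right scaleC_zero_right)

lemma scaleC_minus_left: "scaleC (- c) x = - scaleC c (x::'a::complex_banach)"
  by (metis add.right_inverse minus_unique scaleC_add_left scaleC_zero_left)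

lemma scaleC_diff_right: "scaleC c (x - y) = scaleC c x - scaleC c (y::'a::complex_banach)"
  by (metis scaleC_add_right scaleC_minus_right uminus_add_conv_diff add.commute)

lemma scaleC_i_i: "scaleC \<i> (scaleC \<i> x) = - (x::'a::complex_banach)"
  by (simp add: scaleC_scaleC scaleC_minus_one)

lemma star_zero [simp]: "star (0::'a::cstar_algebra) = 0"
  by (metis add_cancel_right_right star_add)

section \<open>Calculus of the inner product and its continuity\<close>

context hilbert_module
begin

lemma inn_add_left: "inn (x + y) z = inn x z + inn y z"
  by (metis inn_add_right inn_star star_add)

lemma inn_scaleC_left: "inn (scaleC c x) y = scaleC (cnj c) (inn x y)"
  by (metis inn_scaleC_right inn_star star_scaleC)

lemma inn_zero_right [simp]: "inn x 0 = 0"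
  by (metis add_cancel_right_right inn_add_right)

lemma inn_zero_left [simp]: "inn 0 x = 0"
  by (metis inn_zero_right inn_star star_zero)

lemma inn_minus_right: "inn x (- y) = - inn x y"
  by (metis inn_scaleC_right scaleC_minus_one)

lemma inn_minus_left: "inn (- x) y = - inn x y"
  by (metis inn_add_left inn_zero_left add.right_inverse minus_unique)

lemma inn_diff_right: "inn x (y - z) = inn x y - inn x z"
  by (metis diff_conv_add_uminus inn_add_right inn_minus_right)

lemma inn_diff_left: "inn (x - y) z = inn x z - inn y z"
  by (metis diff_conv_add_uminus inn_add_left inn_minus_left)

lemma inn_scaleR_right: "inn x (r *\<^sub>R y) = r *\<^sub>R inn x y"
  by (simp add: scaleR_eq_scaleC inn_scaleC_right)

lemma inn_scaleR_left: "inn (r *\<^sub>R x) y = r *\<^sub>R inn x y"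
  by (simp add: scaleR_eq_scaleC inn_scaleC_left)

lemmas inn_simps = inn_add_left inn_add_right inn_diff_left inn_diff_right inn_minus_left
  inn_minus_right inn_scaleR_left inn_scaleR_right inn_scaleC_left inn_scaleC_right

lemma norm_inn_self: "norm (inn x x) = (norm x)\<^sup>2"
  by (simp add: norm_eq_sqrt_inn)

lemma inn_eqI_right: "(\<And>y. inn y x = inn y z) \<Longrightarrow> x = z"
  by (metis inn_definite inn_diff_right eq_iff_diff_eq_0)

lemma inn_eqI_left: "(\<And>y. inn x y = inn z y) \<Longrightarrow> x = z"
  by (metis inn_eqI_right inn_star)

text \<open>The sharp Cauchy--Schwarz inequality rests on positivity in the algebra; this weaker bound
  uses only polarization and the triangle inequality.\<close>

lemma norm_inn_le_sum: "norm (inn x y) \<le> (norm x + norm y)\<^sup>2"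
proof -
  have re: "norm (inn x y + inn y x) \<le> (norm x + norm y)\<^sup>2" for x y
  proof -
    have "2 *\<^sub>R (inn x y + inn y x) = inn (x + y) (x + y) - inn (x - y) (x - y)"
      by (simp add: inn_simps scaleR_2)
    then have "2 * norm (inn x y + inn y x) \<le> (norm (x + y))\<^sup>2 + (norm (x - y))\<^sup>2"
      by (metis norm_inn_self norm_scaleR norm_triangle_ineq4 abs_numeral)
    also have "\<dots> \<le> (norm x + norm y)\<^sup>2 + (norm x + norm y)\<^sup>2"
      by (intro add_mono power_mono norm_triangle_ineq norm_triangle_ineq4 norm_ge_zero)
    finally show ?thesis by simp
  qed
  \<comment> \<open>The second bracket is the first with \<open>scaleC \<i> y\<close> in place of
    \<open>y\<close>, a vector of the same norm, so \<open>re\<close> bounds both.\<close>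
  have "2 *\<^sub>R inn x y = (inn x y + inn y x)
      - scaleC \<i> (inn x (scaleC \<i> y) + inn (scaleC \<i> y) x)"
    by (simp add: inn_simps scaleC_add_right scaleC_diff_right scaleC_i_i scaleC_minus_left
        scaleC_minus_right scaleR_2)
  then have "2 * norm (inn x y) \<le> norm (inn x y + inn y x)
      + norm (scaleC \<i> (inn x (scaleC \<i> y) + inn (scaleC \<i> y) x))"
    by (metis norm_scaleR norm_triangle_ineq4 abs_numeral)
  also have "\<dots> \<le> (norm x + norm y)\<^sup>2 + (norm x + norm y)\<^sup>2"
    using re[of x y] re[of x "scaleC \<i> y"] by (simp add: norm_scaleC)
  finally show ?thesis by simp
qed

text \<open>By homogeneity unit vectors suffice, and for them the previous bound is
  \<open>(1 + 1)^2\<close>, hence the 4.\<close>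

lemma norm_inn_le: "norm (inn x y) \<le> norm x * norm y * 4"
proof (cases "x = 0 \<or> y = 0")
  case False
  let ?u = "(1 / norm x) *\<^sub>R x" and ?v = "(1 / norm y) *\<^sub>R y"
  have "norm (inn ?u ?v) \<le> (norm ?u + norm ?v)\<^sup>2"
    by (rule norm_inn_le_sum)
  then have "norm (inn x y) / (norm x * norm y) \<le> 4"
    using False by (simp add: inn_simps mult.commute)
  then show ?thesis
    using False by (simp add: divide_le_eq mult.commute)
qed auto

lemma bounded_bilinear_inn: "bounded_bilinear inn"
  by (rule bounded_bilinear.intro) (use norm_inn_le in \<open>auto simp: inn_simps\<close>)

end

section \<open>Adjointable operators between two modules\<close>

locale hilbert_module_pair = H: hilbert_module innH actH + K: hilbert_module innK actK
  for innH :: "'h::complex_banach \<Rightarrow> 'h \<Rightarrow> 'a::cstar_algebra"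
    and actH :: "'h \<Rightarrow> 'a \<Rightarrow> 'h"
    and innK :: "'k::complex_banach \<Rightarrow> 'k \<Rightarrow> 'a"
    and actK :: "'k \<Rightarrow> 'a \<Rightarrow> 'k"
begin

lemma is_adjoint_swap: "is_adjoint innH innK T S \<Longrightarrow> is_adjoint innK innH S T"
  unfolding is_adjoint_def by (metis H.inn_star K.inn_star)

lemma is_adjoint_unique:
  assumes "is_adjoint innH innK T S" "is_adjoint innH innK T S'"
  shows "S = S'"
proof
  show "S y = S' y" for y
    using assms unfolding is_adjoint_def by (intro H.inn_eqI_right) metis
qed

lemma adj_eqI: "is_adjoint innH innK T S \<Longrightarrow> adj innH innK T = S"
  unfolding adj_def using is_adjoint_unique by blast

lemma is_adjoint_adj: "T \<in> adjointable innH innK \<Longrightarrow> is_adjoint innH innK T (adj innH innK T)"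
  using adj_eqI unfolding adjointable_def by blast

lemma adjoint_scaleC:
  assumes "is_adjoint innH innK T S"
  shows "T (scaleC c x) = scaleC c (T x)"
  using assms by (intro K.inn_eqI_left) (simp add: is_adjoint_def H.inn_simps K.inn_simps)

lemma adjoint_act:
  assumes "is_adjoint innH innK T S"
  shows "T (actH x a) = actK (T x) a"
proof (intro K.inn_eqI_right)
  fix y
  have "innK y (T (actH x a)) = innH (S y) (actH x a)"
    using is_adjoint_swap[OF assms] by (simp add: is_adjoint_def)
  also have "\<dots> = innK y (T x) * a"
    using is_adjoint_swap[OF assms] by (simp add: is_adjoint_def H.inn_act_right)
  finally show "innK y (T (actH x a)) = innK y (actK (T x) a)"
    by (simp add: K.inn_act_right)
qed

text \<open>The Hellinger--Toeplitz theorem.\<close>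

lemma adjoint_bounded_linear:
  assumes adj: "is_adjoint innH innK T S"
  shows "bounded_linear T"
proof -
  have eq: "innK (T x) y = innH x (S y)" for x y
    using adj by (simp add: is_adjoint_def)
  have add: "T (x + y) = T x + T y" for x y
    by (intro K.inn_eqI_left) (simp add: eq H.inn_simps K.inn_simps)
  have scale: "T (r *\<^sub>R x) = r *\<^sub>R T x" for r x
    by (simp add: scaleR_eq_scaleC adjoint_scaleC[OF adj])
  \<comment> \<open>Baire's theorem needs closed sets while \<open>T\<close> is not yet known to be
    continuous. The bound is therefore stated through \<open>S\<close>, where it is continuous in
    \<open>x\<close>; adjointness then places every \<open>x\<close> in some
    \<open>F n\<close>.\<close>
  define F where "F n = {x. \<forall>y. norm (innH x (S y)) \<le> real n * norm y}" for n :: nat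
  have closed: "closed (F n)" for n
    unfolding F_def
    by (intro closed_Collect_all closed_Collect_le continuous_on_norm continuous_on_const
        bounded_linear.continuous_on[OF bounded_bilinear.bounded_linear_left[OF H.bounded_bilinear_inn]]
        continuous_on_id)
  have cover: "\<Union>(range F) = UNIV"
  proof -
    have "x \<in> F (nat \<lceil>4 * norm (T x)\<rceil>)" for x
    proof -
      have "norm (innH x (S y)) \<le> real (nat \<lceil>4 * norm (T x)\<rceil>) * norm y" for y
      proof -
        have "norm (innH x (S y)) \<le> (4 * norm (T x)) * norm y"
          using K.norm_inn_le[of "T x" y] by (simp add: eq mult_ac)
        also have "\<dots> \<le> real (nat \<lceil>4 * norm (T x)\<rceil>) * norm y"
          by (intro mult_right_mono real_nat_ceiling_ge norm_ge_zero)
        finally show ?thesis .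
      qed
      then show ?thesis by (simp add: F_def)
    qed
    then show ?thesis by blast
  qed
  have "\<exists>n. interior (F n) \<noteq> {}"
  proof (rule ccontr)
    assume "\<not> ?thesis"
    then have "(euclidean :: 'h topology) interior_of (\<Union>(range F)) = {}"
      using closed by (intro Baire_category_alt disjI1 completely_metrizable_space_euclidean) auto
    then show False by (simp add: cover)
  qed
  then obtain n x0 where "x0 \<in> interior (F n)" by blast
  then obtain e where e: "e > 0" "ball x0 e \<subseteq> F n"
    by (auto simp: mem_interior)
  \<comment> \<open>\<open>z\<close> is a difference of two points of the ball; testing both against
    \<open>T z\<close> bounds the square of its norm by \<open>2 * n * norm (T z)\<close>.\<close>
  have small: "norm (T z) \<le> 2 * n" if "norm z < e" for z
  proof (cases "T z = 0")
    case False
    have "x0 \<in> F n" "x0 + z \<in> F n"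
      using e that by (auto simp: subset_iff dist_norm)
    then have le: "norm (innH x0 (S (T z))) \<le> n * norm (T z)"
        "norm (innH (x0 + z) (S (T z))) \<le> n * norm (T z)"
      by (auto simp: F_def)
    have "innK (T z) (T z) = innH (x0 + z) (S (T z)) - innH x0 (S (T z))"
      by (simp add: eq H.inn_simps)
    then have "(norm (T z))\<^sup>2 \<le> n * norm (T z) + n * norm (T z)"
      using le by (metis K.norm_inn_self norm_triangle_ineq4 add_mono order_trans)
    then show ?thesis
      using False by (simp add: power2_eq_square flip: distrib_right mult_2)
  qed simp
  \<comment> \<open>Scaling a nonzero vector to norm \<open>e / 2\<close> turns the bound
    \<open>2 * n\<close> into the constant \<open>4 * n / e\<close>.\<close>
  show ?thesis
  proof (rule bounded_linear_intro[where K = "4 * n / e"])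
    show "norm (T x) \<le> norm x * (4 * n / e)" for x
    proof (cases "x = 0")
      case True
      then show ?thesis using scale[of 0 0] by simp
    next
      case False
      have "norm (T ((e / (2 * norm x)) *\<^sub>R x)) \<le> 2 * n"
        using e False by (intro small) simp
      then show ?thesis
        using e False by (simp add: scale field_simps)
    qed
  qed (auto simp: add scale)
qed

end

section \<open>Square roots of operators near the identity\<close>

text \<open>For linear \<open>B\<close> every iterate is a polynomial in \<open>B\<close>, so
  commutation with \<open>B\<close> and symmetry carry over to the iterates and then to their
  pointwise limit.\<close>

primrec sqrt_iter :: "('b::real_normed_vector \<Rightarrow> 'b) \<Rightarrow> nat \<Rightarrow> 'b \<Rightarrow> 'b" where
  "sqrt_iter B 0 = (\<lambda>x. 0)"
| "sqrt_iter B (Suc n) = (\<lambda>x. (1/2) *\<^sub>R (B x + sqrt_iter B n (sqrt_iter B n x)))"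

text \<open>The scalar case \<open>B = 1\<close>, which majorizes the iteration for every contraction \<open>B\<close>.\<close>

primrec sqrt_iter_bound :: "nat \<Rightarrow> real" where
  "sqrt_iter_bound 0 = 0"
| "sqrt_iter_bound (Suc n) = (1 + (sqrt_iter_bound n)\<^sup>2) / 2"

text \<open>For \<open>B = 1 - A\<close> the iteration tends to the solution \<open>Y\<close> of \<open>Y = (B + Y\<^sup>2) / 2\<close>,
  so that \<open>(1 - Y)\<^sup>2 = A\<close>.\<close>

definition unit_root :: "('b::real_normed_vector \<Rightarrow> 'b) \<Rightarrow> 'b \<Rightarrow> 'b" where
  "unit_root A x = x - lim (\<lambda>n. sqrt_iter (\<lambda>x. x - A x) n x)"

lemma sqrt_iter_bound_range: "0 \<le> sqrt_iter_bound n \<and> sqrt_iter_bound n \<le> 1"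
proof (induction n)
  case (Suc n)
  then have "(sqrt_iter_bound n)\<^sup>2 \<le> 1"
    by (simp add: power_le_one)
  then show ?case by simp
qed simp

text \<open>The increment is \<open>(1 - y)^2 / 2\<close> for
  \<open>y = sqrt_iter_bound n\<close>.\<close>

lemma sqrt_iter_bound_mono: "sqrt_iter_bound n \<le> sqrt_iter_bound (Suc n)"
proof -
  have "0 \<le> (1 - sqrt_iter_bound n)\<^sup>2" by simp
  then show ?thesis by (simp add: power2_diff)
qed

lemma convergent_sqrt_iter_bound: "convergent sqrt_iter_bound"
proof -
  have "incseq sqrt_iter_bound"
    by (rule incseq_SucI) (rule sqrt_iter_bound_mono)
  then show ?thesis
    using incseq_convergent sqrt_iter_bound_range unfolding convergent_def by metis
qed

context
  fixes B :: "'b::banach \<Rightarrow> 'b"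
  assumes linear: "linear B" and contr: "\<And>x. norm (B x) \<le> norm x"
begin

lemma linear_sqrt_iter: "linear (sqrt_iter B n)"
proof (induction n)
  case (Suc n)
  then have "linear (\<lambda>x. sqrt_iter B n (sqrt_iter B n x))"
    using linear_compose[of "sqrt_iter B n" "sqrt_iter B n"] by (simp add: o_def)
  then show ?case
    using linear by (simp add: linear_compose_add linear_compose_scale_right)
qed (simp add: linear_zero)

lemma norm_sqrt_iter_le: "norm (sqrt_iter B n x) \<le> sqrt_iter_bound n * norm x"
proof (induction n arbitrary: x)
  case (Suc n)
  have "norm (sqrt_iter B n (sqrt_iter B n x)) \<le> sqrt_iter_bound n * (sqrt_iter_bound n * norm x)"
    using Suc[of "sqrt_iter B n x"] Suc[of x] sqrt_iter_bound_range[of n]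
    by (meson mult_left_mono order_trans)
  then have "norm (B x + sqrt_iter B n (sqrt_iter B n x))
      \<le> norm x + sqrt_iter_bound n * (sqrt_iter_bound n * norm x)"
    using contr[of x] by (meson norm_triangle_le add_mono)
  then have "(1/2) * norm (B x + sqrt_iter B n (sqrt_iter B n x))
      \<le> (1/2) * (norm x + sqrt_iter_bound n * (sqrt_iter_bound n * norm x))"
    by simp
  then show ?case
    by (simp add: power2_eq_square distrib_right del: scaleR_right_distrib)
qed simp

text \<open>By linearity \<open>Y^2 - Z^2 = Y (Y - Z) + (Y - Z) Z\<close>, so the bounds on the
  factors add up to the scalar difference \<open>y^2 - z^2\<close>.\<close>

lemma norm_sqrt_iter_Suc_diff_le:
  "norm (sqrt_iter B (Suc n) x - sqrt_iter B n x)
    \<le> (sqrt_iter_bound (Suc n) - sqrt_iter_bound n) * norm x"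
proof (induction n arbitrary: x)
  case 0
  then show ?case using contr[of x] by simp
next
  case (Suc n)
  let ?Y = "sqrt_iter B (Suc n)" and ?Z = "sqrt_iter B n"
  let ?y = "sqrt_iter_bound (Suc n)" and ?z = "sqrt_iter_bound n"
  have y: "0 \<le> ?y" and yz: "0 \<le> ?y - ?z"
    using sqrt_iter_bound_range[of "Suc n"] sqrt_iter_bound_mono[of n] by auto
  have 1: "norm (?Y (?Y x - ?Z x)) \<le> ?y * ((?y - ?z) * norm x)"
    by (rule order_trans[OF norm_sqrt_iter_le mult_left_mono[OF Suc y]])
  have 2: "norm (?Y (?Z x) - ?Z (?Z x)) \<le> (?y - ?z) * (?z * norm x)"
    by (rule order_trans[OF Suc mult_left_mono[OF norm_sqrt_iter_le yz]])
  have "?Y (?Y x) - ?Z (?Z x) = ?Y (?Y x - ?Z x) + (?Y (?Z x) - ?Z (?Z x))"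
    by (simp add: linear_diff[OF linear_sqrt_iter] del: sqrt_iter.simps)
  then have "norm (?Y (?Y x) - ?Z (?Z x))
      \<le> ?y * ((?y - ?z) * norm x) + (?y - ?z) * (?z * norm x)"
    using 1 2 by (metis norm_triangle_le add_mono)
  also have "\<dots> = (?y\<^sup>2 - ?z\<^sup>2) * norm x"
    by (simp add: power2_eq_square algebra_simps del: sqrt_iter_bound.simps)
  finally have le: "norm (?Y (?Y x) - ?Z (?Z x)) \<le> (?y\<^sup>2 - ?z\<^sup>2) * norm x" .
  have "sqrt_iter B (Suc (Suc n)) x - ?Y x = (1/2) *\<^sub>R (?Y (?Y x) - ?Z (?Z x))"
    by (simp only: sqrt_iter.simps(2)[of B "Suc n"])
       (simp add: scaleR_right_diff_distrib scaleR_right_distrib)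
  then have "norm (sqrt_iter B (Suc (Suc n)) x - ?Y x) = norm (?Y (?Y x) - ?Z (?Z x)) / 2"
    by (simp del: sqrt_iter.simps)
  moreover have "sqrt_iter_bound (Suc (Suc n)) - ?y = (?y\<^sup>2 - ?z\<^sup>2) / 2"
    by (simp only: sqrt_iter_bound.simps(2)[of "Suc n"]) (simp add: field_simps)
  ultimately show ?case
    using le by (simp only:)
qed

lemma norm_sqrt_iter_diff_le:
  "m \<le> n \<Longrightarrow> norm (sqrt_iter B n x - sqrt_iter B m x)
    \<le> (sqrt_iter_bound n - sqrt_iter_bound m) * norm x"
proof (induction n rule: dec_induct)
  case (step n)
  then show ?case
    using norm_sqrt_iter_Suc_diff_le[of n x]
      norm_triangle_ineq[of "sqrt_iter B (Suc n) x - sqrt_iter B n x" "sqrt_iter B n x - sqrt_iter B m x"]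
    by (simp add: algebra_simps del: sqrt_iter.simps sqrt_iter_bound.simps)
qed simp

text \<open>The differences are dominated by those of a convergent real sequence, so the iterates at
  \<open>x\<close> form a Cauchy sequence.\<close>

lemma convergent_sqrt_iter: "convergent (\<lambda>n. sqrt_iter B n x)"
proof -
  have "Cauchy (\<lambda>n. sqrt_iter_bound n * norm x)"
    using convergent_sqrt_iter_bound
    by (intro convergent_Cauchy) (auto intro: convergent_mult convergent_const)
  have "Cauchy (\<lambda>n. sqrt_iter B n x)"
    unfolding Cauchy_iff
  proof (intro allI impI)
    fix e :: real assume "e > 0"
    then obtain M where M: "\<And>m n. m \<ge> M \<Longrightarrow> n \<ge> M \<Longrightarrow>
        norm (sqrt_iter_bound m * norm x - sqrt_iter_bound n * norm x) < e"
      using \<open>Cauchy (\<lambda>n. sqrt_iter_bound n * norm x)\<close> unfolding Cauchy_iff by blast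
    have *: "norm (sqrt_iter B n x - sqrt_iter B m x) < e" if "m \<ge> M" "m \<le> n" for m n
      using norm_sqrt_iter_diff_le[OF \<open>m \<le> n\<close>, of x] M[of n m] that
      by (auto simp: left_diff_distrib)
    show "\<exists>M. \<forall>m\<ge>M. \<forall>n\<ge>M. norm (sqrt_iter B m x - sqrt_iter B n x) < e"
      using * by (metis nle_le norm_minus_commute)
  qed
  then show ?thesis by (rule Cauchy_convergent)
qed

end

context
  fixes A :: "'b::banach \<Rightarrow> 'b"
  assumes linear: "linear A" and contr: "\<And>x. norm (x - A x) \<le> norm x"
begin

lemma linear_one_minus: "linear (\<lambda>x. x - A x)"
  by (intro linear_compose_sub linear linear_id[unfolded id_def])

lemma sqrt_iter_tendsto_unit_root:
  "(\<lambda>n. sqrt_iter (\<lambda>x. x - A x) n x) \<longlonglongrightarrow> x - unit_root A x"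
  using convergent_sqrt_iter[OF linear_one_minus contr] by (simp add: unit_root_def convergent_LIMSEQ_iff)

lemma norm_unit_root_le: "norm (x - unit_root A x) \<le> norm x"
proof (rule LIMSEQ_le_const2[OF tendsto_norm[OF sqrt_iter_tendsto_unit_root]])
  have "norm (sqrt_iter (\<lambda>x. x - A x) n x) \<le> 1 * norm x" for n
    using norm_sqrt_iter_le[OF linear_one_minus contr, of n x] sqrt_iter_bound_range[of n]
    by (meson mult_right_mono norm_ge_zero order_trans)
  then show "\<exists>N. \<forall>n\<ge>N. norm (sqrt_iter (\<lambda>x. x - A x) n x) \<le> norm x"
    by simp
qed

lemma linear_unit_root: "linear (unit_root A)"
proof (rule linearI)
  note lin = linear_sqrt_iter[OF linear_one_minus contr] and T = sqrt_iter_tendsto_unit_root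
  show "unit_root A (x + y) = unit_root A x + unit_root A y" for x y
    using LIMSEQ_unique[OF T[of "x + y", unfolded linear_add[OF lin]] tendsto_add[OF T[of x] T[of y]]]
    by (simp add: algebra_simps)
  show "unit_root A (r *\<^sub>R x) = r *\<^sub>R unit_root A x" for r x
    using LIMSEQ_unique[OF T[of "r *\<^sub>R x", unfolded linear_scale[OF lin]]
        tendsto_scaleR[OF tendsto_const T[of x]]]
    by (simp add: algebra_simps)
qed

lemma unit_root_square: "unit_root A (unit_root A x) = A x"
proof -
  let ?Y = "sqrt_iter (\<lambda>x. x - A x)"
  define y where "y = x - unit_root A x"
  note lin = linear_sqrt_iter[OF linear_one_minus contr]
  have Yx: "(\<lambda>n. ?Y n x) \<longlonglongrightarrow> y" and Yy: "(\<lambda>n. ?Y n y) \<longlonglongrightarrow> y - unit_root A y"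
    unfolding y_def by (rule sqrt_iter_tendsto_unit_root)+
  \<comment> \<open>In \<open>?Y n (?Y n x)\<close> operator and argument vary together. As all
    iterates are contractions, replacing the inner \<open>?Y n x\<close> by its limit
    \<open>y\<close> costs nothing in the limit.\<close>
  have "(\<lambda>n. ?Y n (?Y n x - y)) \<longlonglongrightarrow> 0"
  proof (rule tendsto_norm_zero_cancel, rule tendsto_sandwich[OF _ _ tendsto_const])
    show "(\<lambda>n. norm (?Y n x - y)) \<longlonglongrightarrow> 0"
      using Yx by (simp add: LIM_zero_iff tendsto_norm_zero_iff)
    have "norm (?Y n z) \<le> 1 * norm z" for n z
      using norm_sqrt_iter_le[OF linear_one_minus contr, of n z] sqrt_iter_bound_range[of n]
      by (meson mult_right_mono norm_ge_zero order_trans)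
    then show "\<forall>\<^sub>F n in sequentially. norm (?Y n (?Y n x - y)) \<le> norm (?Y n x - y)"
      by simp
  qed simp
  from tendsto_add[OF this Yy] have "(\<lambda>n. ?Y n (?Y n x)) \<longlonglongrightarrow> y - unit_root A y"
    by (simp add: linear_diff[OF lin])
  then have "(\<lambda>n. ?Y (Suc n) x) \<longlonglongrightarrow> (1/2) *\<^sub>R ((x - A x) + (y - unit_root A y))"
    by (simp only: sqrt_iter.simps) (intro tendsto_intros)
  from LIMSEQ_unique[OF this LIMSEQ_Suc[OF Yx]]
  have "(x - A x) + (y - unit_root A y) = 2 *\<^sub>R y"
    by (metis scaleR_half_double scaleR_2 scaleR_right_distrib)
  then show ?thesis
    by (simp add: y_def linear_diff[OF linear_unit_root] scaleR_2 algebra_simps)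
qed

end

text \<open>An intertwiner passes through the iterates by induction and through the limit by
  continuity. Taking \<open>A' = A\<close> yields commutation; distinct operators occur when squares
  are intertwined.\<close>

lemma unit_root_intertwine:
  fixes A :: "'b::banach \<Rightarrow> 'b" and A' :: "'c::banach \<Rightarrow> 'c"
  assumes A: "linear A" "\<And>x. norm (x - A x) \<le> norm x"
    and A': "linear A'" "\<And>x. norm (x - A' x) \<le> norm x"
    and C: "bounded_linear C" "\<And>x. C (A x) = A' (C x)"
  shows "C (unit_root A x) = unit_root A' (C x)"
proof -
  interpret C: bounded_linear C by fact
  have *: "C (sqrt_iter (\<lambda>x. x - A x) n x) = sqrt_iter (\<lambda>x. x - A' x) n (C x)" for n x
    by (induction n arbitrary: x) (simp_all add: C.add C.diff C.scaleR C.zero C(2))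
  have "(\<lambda>n. C (sqrt_iter (\<lambda>x. x - A x) n x)) \<longlonglongrightarrow> C (x - unit_root A x)"
    by (intro C.tendsto sqrt_iter_tendsto_unit_root A)
  moreover have "(\<lambda>n. C (sqrt_iter (\<lambda>x. x - A x) n x)) \<longlonglongrightarrow> C x - unit_root A' (C x)"
    unfolding * by (intro sqrt_iter_tendsto_unit_root A')
  ultimately show ?thesis
    using LIMSEQ_unique by (fastforce simp: C.diff)
qed

section \<open>Selfadjoint operators on one module\<close>

context hilbert_module
begin

abbreviation selfadj :: "('h \<Rightarrow> 'h) \<Rightarrow> bool" where
  "selfadj A \<equiv> is_adjoint inn inn A A"

lemma pair_self: "hilbert_module_pair inn act inn act"
  by (intro hilbert_module_pair.intro hilbert_module_axioms)

lemma selfadjD: "selfadj A \<Longrightarrow> inn (A x) y = inn x (A y)"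
  by (simp add: is_adjoint_def)

lemma selfadj_bounded_linear: "selfadj A \<Longrightarrow> bounded_linear A"
  by (rule hilbert_module_pair.adjoint_bounded_linear[OF pair_self])

lemma selfadj_linear: "selfadj A \<Longrightarrow> linear A"
  using selfadj_bounded_linear bounded_linear.linear by blast

lemma selfadj_commuting_comp:
  "selfadj A \<Longrightarrow> selfadj B \<Longrightarrow> (\<And>x. A (B x) = B (A x)) \<Longrightarrow> selfadj (\<lambda>x. A (B x))"
  by (simp add: is_adjoint_def)

lemma selfadj_square: "selfadj A \<Longrightarrow> selfadj (\<lambda>x. A (A x))"
  by (simp add: is_adjoint_def)

lemma selfadj_diff: "selfadj A \<Longrightarrow> selfadj B \<Longrightarrow> selfadj (\<lambda>x. A x - B x)"
  by (simp add: is_adjoint_def inn_simps)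

lemma selfadj_add: "selfadj A \<Longrightarrow> selfadj B \<Longrightarrow> selfadj (\<lambda>x. A x + B x)"
  by (simp add: is_adjoint_def inn_simps)

lemma selfadj_scaleR: "selfadj A \<Longrightarrow> selfadj (\<lambda>x. r *\<^sub>R A x)"
  by (simp add: is_adjoint_def inn_simps)

lemma selfadj_id: "selfadj (\<lambda>x. x)"
  by (simp add: is_adjoint_def)

lemma selfadj_square_eq_zero: "selfadj A \<Longrightarrow> A (A x) = 0 \<Longrightarrow> A x = 0"
  by (metis inn_definite inn_zero_right selfadjD)

text \<open>The iterates are symmetric, and the inner product is continuous in each
  variable.\<close>

lemma selfadj_unit_root:
  assumes A: "selfadj A" and contr: "\<And>x. norm (x - A x) \<le> norm x"
  shows "selfadj (unit_root A)"
proof -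
  let ?Y = "sqrt_iter (\<lambda>x. x - A x)"
  have sym: "inn (?Y n x) y = inn x (?Y n y)" for n x y
    by (induction n arbitrary: x y) (simp_all add: inn_simps selfadjD[OF A])
  have lim: "(\<lambda>n. ?Y n x) \<longlonglongrightarrow> x - unit_root A x" for x
    by (rule sqrt_iter_tendsto_unit_root[OF selfadj_linear[OF A] contr])
  note tendsto = bounded_bilinear.tendsto[OF bounded_bilinear_inn]
  have "inn (x - unit_root A x) y = inn x (y - unit_root A y)" for x y
    using LIMSEQ_unique[OF tendsto[OF lim[of x] tendsto_const[of y], unfolded sym]
        tendsto[OF tendsto_const[of x] lim[of y]]] .
  then show ?thesis
    by (simp add: is_adjoint_def inn_simps)
qed

text \<open>The cross terms cancel in \<open>(h - ik)(h + ik)\<close> and in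
  \<open>(h + ik)(h - ik)\<close>. This serves twice: to get isometries when
  \<open>h^2 + k^2 = 1\<close> and zero operators when \<open>h^2 + k^2 = 0\<close>.\<close>

lemma inn_commuting_combination:
  assumes h: "selfadj h" and k: "selfadj k" and comm: "\<And>x. h (k x) = k (h x)"
  shows "inn (h x + scaleC \<i> (k x)) (h x + scaleC \<i> (k x)) = inn x (h (h x) + k (k x))"
    and "inn (h x - scaleC \<i> (k x)) (h x - scaleC \<i> (k x)) = inn x (h (h x) + k (k x))"
  by (simp_all add: inn_simps selfadjD[OF h] selfadjD[OF k] comm scaleC_add_right scaleC_diff_right
      scaleC_i_i scaleC_minus_left scaleC_minus_right)

text \<open>With \<open>k = sqrt (1 - h\<^sup>2)\<close> the operators \<open>h \<plusminus> ik\<close> are isometric, hence their combination \<open>k\<close>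
  is a contraction.\<close>

lemma norm_one_minus_square_le:
  assumes h: "selfadj h" and contr: "\<And>x. norm (h x) \<le> norm x"
  shows "norm (x - h (h x)) \<le> norm x"
proof -
  define A where "A x = x - h (h x)" for x
  have A: "selfadj A"
    unfolding A_def by (intro selfadj_diff selfadj_id selfadj_square h)
  have A_contr: "norm (x - A x) \<le> norm x" for x
    using order_trans[OF contr[of "h x"] contr[of x]] by (simp add: A_def)
  define k where "k = unit_root A"
  interpret h: bounded_linear h by (rule selfadj_bounded_linear[OF h])
  have k: "selfadj k"
    unfolding k_def by (rule selfadj_unit_root[OF A A_contr])
  have kk: "k (k x) = x - h (h x)" for x
    unfolding k_def by (simp add: unit_root_square[OF selfadj_linear[OF A] A_contr] A_def)
  have comm: "h (k x) = k (h x)" for x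
    unfolding k_def
    by (rule unit_root_intertwine[OF selfadj_linear[OF A] A_contr selfadj_linear[OF A] A_contr])
       (auto simp: A_def h.diff h.bounded_linear_axioms)
  have "norm (k x) \<le> norm x" for x
  proof -
    have "norm (h x + scaleC \<i> (k x)) = norm x" "norm (h x - scaleC \<i> (k x)) = norm x"
      unfolding norm_eq_sqrt_inn inn_commuting_combination[OF h k comm] by (simp_all add: kk)
    moreover have "scaleC \<i> (2 *\<^sub>R k x) = (h x + scaleC \<i> (k x)) - (h x - scaleC \<i> (k x))"
      by (simp add: scaleR_2 scaleC_add_right)
    ultimately have "norm (scaleC \<i> (2 *\<^sub>R k x)) \<le> norm x + norm x"
      by (metis norm_triangle_ineq4)
    then show ?thesis by (simp add: norm_scaleC)
  qed
  then have "norm (k (k x)) \<le> norm x"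
    using order_trans by blast
  then show ?thesis by (simp add: kk)
qed

end

section \<open>Positive operators\<close>

context hilbert_module
begin

text \<open>For a selfadjoint operator the norm condition says that the spectrum lies in \<open>[0, 2t]\<close>;
  in contrast to the existence of a factorization it is obviously stable under sums.\<close>

definition norm_pos :: "real \<Rightarrow> ('h \<Rightarrow> 'h) \<Rightarrow> bool" where
  "norm_pos t A \<longleftrightarrow> selfadj A \<and> t > 0 \<and> (\<forall>x. norm (t *\<^sub>R x - A x) \<le> t * norm x)"

lemma norm_pos_selfadj: "norm_pos t A \<Longrightarrow> selfadj A"
  by (simp add: norm_pos_def)

text \<open>Brings two operators to a common parameter, which \<open>scaled_root_intertwine\<close>
  requires.\<close>

lemma norm_pos_mono:
  assumes "norm_pos t A" "t \<le> s"
  shows "norm_pos s A"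
proof -
  have "norm (s *\<^sub>R x - A x) \<le> s * norm x" for x
  proof -
    have "s *\<^sub>R x - A x = (s - t) *\<^sub>R x + (t *\<^sub>R x - A x)"
      by (simp add: algebra_simps)
    also have "norm \<dots> \<le> (s - t) * norm x + t * norm x"
      using assms by (intro norm_triangle_le add_mono) (auto simp: norm_pos_def)
    finally show ?thesis by (simp add: algebra_simps)
  qed
  then show ?thesis
    using assms by (auto simp: norm_pos_def)
qed

lemma norm_pos_add:
  assumes "norm_pos s A" "norm_pos t B"
  shows "norm_pos (s + t) (\<lambda>x. A x + B x)"
proof -
  have "norm ((s + t) *\<^sub>R x - (A x + B x)) \<le> (s + t) * norm x" for x
  proof -
    have "(s + t) *\<^sub>R x - (A x + B x) = (s *\<^sub>R x - A x) + (t *\<^sub>R x - B x)"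
      by (simp add: algebra_simps)
    also have "norm \<dots> \<le> s * norm x + t * norm x"
      using assms by (intro norm_triangle_le add_mono) (auto simp: norm_pos_def)
    finally show ?thesis by (simp add: algebra_simps)
  qed
  then show ?thesis
    using assms by (auto simp: norm_pos_def intro: selfadj_add)
qed

lemma norm_pos_scaleR:
  assumes "norm_pos t A" "r > 0"
  shows "norm_pos (r * t) (\<lambda>x. r *\<^sub>R A x)"
proof -
  have "norm ((r * t) *\<^sub>R x - r *\<^sub>R A x) \<le> (r * t) * norm x" for x
  proof -
    have "norm ((r * t) *\<^sub>R x - r *\<^sub>R A x) = r * norm (t *\<^sub>R x - A x)"
      using assms(2) by (metis norm_scaleR scaleR_right_diff_distrib scaleR_scaleR abs_of_pos)
    also have "\<dots> \<le> r * (t * norm x)"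
      using assms by (simp add: norm_pos_def)
    finally show ?thesis by simp
  qed
  then show ?thesis
    using assms by (auto simp: norm_pos_def intro: selfadj_scaleR)
qed

text \<open>Dividing by a bound \<open>c\<close> reduces to a contraction, where the parameter 1
  works; scaling back turns it into \<open>c^2\<close>.\<close>

lemma norm_pos_square:
  assumes "selfadj h"
  obtains t where "norm_pos t (\<lambda>x. h (h x))"
proof -
  interpret h: bounded_linear h by (rule selfadj_bounded_linear[OF assms])
  obtain c where c: "c > 0" "\<And>x. norm (h x) \<le> norm x * c"
    using h.pos_bounded by blast
  define g where "g x = (1 / c) *\<^sub>R h x" for x
  have "selfadj g"
    unfolding g_def by (rule selfadj_scaleR[OF assms])
  moreover have "norm (g x) \<le> norm x" for x
    using c by (simp add: g_def divide_le_eq)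
  ultimately have "norm (x - g (g x)) \<le> 1 * norm x" for x
    using norm_one_minus_square_le by simp
  with \<open>selfadj g\<close> have "norm_pos 1 (\<lambda>x. g (g x))"
    by (auto simp: norm_pos_def intro: selfadj_square)
  then have "norm_pos (c\<^sup>2 * 1) (\<lambda>x. c\<^sup>2 *\<^sub>R g (g x))"
    by (rule norm_pos_scaleR) (use c in simp)
  then have "norm_pos (c\<^sup>2) (\<lambda>x. h (h x))"
    using c by (simp add: g_def h.scaleR power2_eq_square)
  then show ?thesis by (rule that)
qed

text \<open>Division by \<open>t\<close> brings \<open>A\<close> within distance one of the
  identity, where \<open>unit_root\<close> converges; \<open>sqrt t\<close> undoes the
  scaling.\<close>

definition scaled_root :: "real \<Rightarrow> ('h \<Rightarrow> 'h) \<Rightarrow> 'h \<Rightarrow> 'h" where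
  "scaled_root t A x = sqrt t *\<^sub>R unit_root (\<lambda>x. (1 / t) *\<^sub>R A x) x"

lemma norm_pos_unit:
  assumes "norm_pos t A"
  shows "selfadj (\<lambda>x. (1 / t) *\<^sub>R A x)" "norm (x - (1 / t) *\<^sub>R A x) \<le> norm x"
proof -
  have "norm_pos ((1 / t) * t) (\<lambda>x. (1 / t) *\<^sub>R A x)"
    by (rule norm_pos_scaleR[OF assms]) (use assms in \<open>simp add: norm_pos_def\<close>)
  then show "selfadj (\<lambda>x. (1 / t) *\<^sub>R A x)" "norm (x - (1 / t) *\<^sub>R A x) \<le> norm x"
    using assms by (auto simp: norm_pos_def)
qed

lemma norm_pos_scaled_root:
  assumes "norm_pos t A"
  shows "norm_pos (sqrt t) (scaled_root t A)"
proof -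
  note u = norm_pos_unit[OF assms]
  have "norm_pos 1 (unit_root (\<lambda>x. (1 / t) *\<^sub>R A x))"
    using selfadj_unit_root[OF u] norm_unit_root_le[OF selfadj_linear[OF u(1)] u(2)]
    by (simp add: norm_pos_def)
  then have "norm_pos (sqrt t * 1) (\<lambda>x. sqrt t *\<^sub>R unit_root (\<lambda>x. (1 / t) *\<^sub>R A x) x)"
    by (rule norm_pos_scaleR) (use assms in \<open>simp add: norm_pos_def\<close>)
  then show ?thesis
    by (simp add: scaled_root_def[abs_def])
qed

lemma scaled_root_square:
  assumes "norm_pos t A"
  shows "scaled_root t A (scaled_root t A x) = A x"
proof -
  note u = norm_pos_unit[OF assms]
  have "t > 0" using assms by (simp add: norm_pos_def)
  then show ?thesis
    by (simp add: scaled_root_def linear_scale[OF linear_unit_root[OF selfadj_linear[OF u(1)] u(2)]]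
        unit_root_square[OF selfadj_linear[OF u(1)] u(2)])
qed

lemma scaled_root_intertwine:
  assumes A: "norm_pos t A" and A': "norm_pos t A'"
    and C: "bounded_linear C" "\<And>x. C (A x) = A' (C x)"
  shows "C (scaled_root t A x) = scaled_root t A' (C x)"
proof -
  note u = norm_pos_unit[OF A] and u' = norm_pos_unit[OF A']
  interpret C: bounded_linear C by fact
  show ?thesis
    using unit_root_intertwine[OF selfadj_linear[OF u(1)] u(2) selfadj_linear[OF u'(1)] u'(2) C(1)]
    by (simp add: scaled_root_def C.scaleR C(2))
qed

text \<open>The hypothesis factors as \<open>(X - iY)(X + iY) = 0\<close>.\<close>

lemma commuting_squares_sum_zero:
  assumes X: "selfadj X" and Y: "selfadj Y" and comm: "\<And>x. X (Y x) = Y (X x)"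
    and zero: "\<And>x. X (X x) + Y (Y x) = 0"
  shows "X x = 0"
proof -
  have "X x + scaleC \<i> (Y x) = 0" "X x - scaleC \<i> (Y x) = 0"
    using inn_commuting_combination[OF X Y comm, of x] by (simp_all add: zero inn_definite)
  then have "X x + X x = 0"
    by (metis eq_iff_diff_eq_0)
  then show ?thesis
    by (metis scaleR_2 scaleR_eq_0_iff zero_neq_numeral)
qed

text \<open>With \<open>Z = P - Q\<close>, \<open>C\<close> a root of \<open>P\<close> and
  \<open>D\<close> a root of \<open>Q\<close>,
  \<open>(CZ)^2 + (DZ)^2 = (P + Q) Z^2 = (P^2 - Q^2) Z = 0\<close>. Hence
  \<open>CZ = DZ = 0\<close>, then \<open>PZ = QZ = 0\<close>, and \<open>Z^2 = 0\<close>.\<close>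

lemma norm_pos_commuting_eq:
  assumes P: "norm_pos s P" and Q: "norm_pos t Q" and comm: "\<And>x. P (Q x) = Q (P x)"
    and eq: "\<And>x. P (P x) = Q (Q x)"
  shows "P x = Q x"
proof -
  note Ps = norm_pos_selfadj[OF P] and Qs = norm_pos_selfadj[OF Q]
  interpret P: bounded_linear P by (rule selfadj_bounded_linear[OF Ps])
  interpret Q: bounded_linear Q by (rule selfadj_bounded_linear[OF Qs])
  define Z where "Z x = P x - Q x" for x
  have Z: "selfadj Z" unfolding Z_def by (rule selfadj_diff[OF Ps Qs])
  interpret Z: bounded_linear Z by (rule selfadj_bounded_linear[OF Z])
  define C where "C = scaled_root s P"
  define D where "D = scaled_root t Q"
  have C: "selfadj C" and D: "selfadj D"
    unfolding C_def D_def using P Q norm_pos_scaled_root norm_pos_selfadj by blast+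
  interpret C: bounded_linear C by (rule selfadj_bounded_linear[OF C])
  have CC: "C (C x) = P x" and DD: "D (D x) = Q x" for x
    unfolding C_def D_def using scaled_root_square P Q by auto
  have QC: "Q (C x) = C (Q x)" and ZC: "Z (C x) = C (Z x)" for x
    unfolding C_def
    by (rule scaled_root_intertwine[OF P P Q.bounded_linear_axioms], simp add: comm)
       (rule scaled_root_intertwine[OF P P Z.bounded_linear_axioms], simp add: Z_def comm P.diff)
  have ZD: "Z (D x) = D (Z x)" and CD: "C (D x) = D (C x)" for x
    unfolding D_def
    by (rule scaled_root_intertwine[OF Q Q Z.bounded_linear_axioms], simp add: Z_def comm Q.diff)
       (rule scaled_root_intertwine[OF Q Q C.bounded_linear_axioms], simp add: QC)
  have X: "selfadj (\<lambda>x. C (Z x))" and Y: "selfadj (\<lambda>x. D (Z x))"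
    by (rule selfadj_commuting_comp[OF C Z ZC[symmetric]], rule selfadj_commuting_comp[OF D Z ZD[symmetric]])
  have ZZ: "P (Z (Z x)) + Q (Z (Z x)) = 0" for x
    by (simp add: Z_def P.diff Q.diff comm eq)
  have zero: "C (Z (C (Z x))) + D (Z (D (Z x))) = 0"
    and comm': "C (Z (D (Z x))) = D (Z (C (Z x)))" for x
    by (simp_all add: ZC ZD CC DD ZZ CD)
  have "C (Z x) = 0"
    by (rule commuting_squares_sum_zero[OF X Y comm' zero])
  moreover have "D (Z x) = 0"
    by (rule commuting_squares_sum_zero[OF Y X comm'[symmetric] zero[unfolded add.commute[of "C _"]]])
  ultimately have "P (Z x) = 0" "Q (Z x) = 0"
    using CC[of "Z x"] DD[of "Z x"] by (simp_all add: C.zero linear_0[OF selfadj_linear[OF D]])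
  then have "Z (Z x) = 0"
    by (simp add: Z_def[of "Z x"])
  then have "Z x = 0"
    by (rule selfadj_square_eq_zero[OF Z])
  then show ?thesis by (simp add: Z_def)
qed

text \<open>\<open>P\<close> commutes with \<open>P^2\<close>, hence with the constructed root of
  \<open>P^2\<close>, so the commuting case of uniqueness applies.\<close>

lemma norm_pos_eq_scaled_root:
  assumes P: "norm_pos s P" and S: "norm_pos t (\<lambda>x. P (P x))"
  shows "P x = scaled_root t (\<lambda>x. P (P x)) x"
proof (rule norm_pos_commuting_eq[OF P norm_pos_scaled_root[OF S]])
  show "P (scaled_root t (\<lambda>x. P (P x)) x) = scaled_root t (\<lambda>x. P (P x)) (P x)" for x
    by (rule scaled_root_intertwine[OF S S selfadj_bounded_linear[OF norm_pos_selfadj[OF P]]]) simp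
qed (simp add: scaled_root_square[OF S])

text \<open>\<open>P\<close> and \<open>Q\<close> are the constructed roots of their squares, and
  constructed roots inherit intertwining.\<close>

lemma norm_pos_square_intertwine:
  assumes P: "norm_pos s P" and Q: "norm_pos t Q" and C: "bounded_linear C"
    and eq: "\<And>x. C (P (P x)) = Q (Q (C x))"
  shows "C (P x) = Q (C x)"
proof -
  obtain a where a: "norm_pos a (\<lambda>x. P (P x))"
    by (rule norm_pos_square[OF norm_pos_selfadj[OF P]])
  obtain b where b: "norm_pos b (\<lambda>x. Q (Q x))"
    by (rule norm_pos_square[OF norm_pos_selfadj[OF Q]])
  define r where "r = max a b"
  have PP: "norm_pos r (\<lambda>x. P (P x))" and QQ: "norm_pos r (\<lambda>x. Q (Q x))"
    using a b norm_pos_mono by (auto simp: r_def)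
  show ?thesis
    using scaled_root_intertwine[OF PP QQ C eq]
    unfolding norm_pos_eq_scaled_root[OF P PP, symmetric] norm_pos_eq_scaled_root[OF Q QQ, symmetric] .
qed

lemma norm_pos_square_eq:
  assumes "norm_pos s P" "norm_pos t Q" "P \<circ> P = Q \<circ> Q"
  shows "P = Q"
proof
  show "P x = Q x" for x
    by (rule norm_pos_square_intertwine[OF assms(1,2) bounded_linear_ident])
       (use assms(3) in \<open>simp add: fun_eq_iff\<close>)
qed

text \<open>Writing \<open>C = X + iY\<close> gives \<open>CC' = 2X\<^sup>2 + 2Y\<^sup>2 - C'C = 2X\<^sup>2 + 2Y\<^sup>2 + E\<^sup>2 =: Q \<ge> 0\<close>.
  Since \<open>C E\<^sup>2 = - Q C\<close>, the squares of \<open>E\<^sup>2\<close> and \<open>Q\<close> are intertwined by \<open>C\<close>, hence so are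
  \<open>E\<^sup>2\<close> and \<open>Q\<close> themselves, and \<open>Q C = - Q C\<close>.\<close>

lemma adjoint_square_neg_square_zero:
  assumes adj: "is_adjoint inn inn C C'" and E: "selfadj E"
    and eq: "\<And>x. C' (C x) = - E (E x)"
  shows "C x = 0"
proof -
  interpret pair: hilbert_module_pair inn act inn act by (rule pair_self)
  note adj' = pair.is_adjoint_swap[OF adj]
  note scaleC = pair.adjoint_scaleC[OF adj] pair.adjoint_scaleC[OF adj']
  interpret C: bounded_linear C by (rule pair.adjoint_bounded_linear[OF adj])
  interpret C': bounded_linear C' by (rule pair.adjoint_bounded_linear[OF adj'])
  have inn: "inn (C x) y = inn x (C' y)" "inn (C' x) y = inn x (C y)" for x y
    using adj adj' by (simp_all add: is_adjoint_def)
  \<comment> \<open>\<open>X\<close> is twice the real part of \<open>C\<close> and \<open>Y\<close>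
    minus twice the imaginary part, so the factor 2 of the formula above becomes \<open>1/2\<close>
    in \<open>Q\<close>.\<close>
  define X where "X x = C x + C' x" for x
  define Y where "Y x = scaleC \<i> (C x - C' x)" for x
  have X: "selfadj X" and Y: "selfadj Y"
    by (simp_all add: is_adjoint_def X_def Y_def inn_simps inn scaleC_diff_right scaleC_minus_left)
  define Q where "Q x = (1/2) *\<^sub>R (X (X x) + Y (Y x)) + E (E x)" for x
  obtain a where a: "norm_pos a (\<lambda>x. X (X x))" by (rule norm_pos_square[OF X])
  obtain b where b: "norm_pos b (\<lambda>x. Y (Y x))" by (rule norm_pos_square[OF Y])
  obtain e where P: "norm_pos e (\<lambda>x. E (E x))" by (rule norm_pos_square[OF E])
  have Q: "norm_pos ((1/2) * (a + b) + e) Q"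
    unfolding Q_def by (rule norm_pos_add[OF norm_pos_scaleR[OF norm_pos_add[OF a b]] P]) simp
  have CC': "C (C' x) = Q x" for x
  proof -
    have "X (X x) + Y (Y x) = 2 *\<^sub>R (C (C' x) + C' (C x))"
      by (simp add: X_def Y_def C.add C'.add C.diff C'.diff scaleC scaleC_diff_right scaleC_i_i scaleR_2)
    then show ?thesis by (simp add: Q_def eq)
  qed
  have CP: "C (E (E x)) = - Q (C x)" for x
    by (metis CC' eq linear_neg[OF C.linear] minus_minus)
  interpret Q: bounded_linear Q by (rule selfadj_bounded_linear[OF norm_pos_selfadj[OF Q]])
  have "C (E (E (E (E x)))) = Q (Q (C x))" for x
    by (simp add: CP linear_neg[OF Q.linear])
  then have "C (E (E x)) = Q (C x)"
    by (rule norm_pos_square_intertwine[OF P Q C.bounded_linear_axioms])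
  then have "Q (C x) + Q (C x) = 0"
    using CP by (metis add.right_inverse)
  then have "Q (C x) = 0"
    by (metis scaleR_2 scaleR_eq_0_iff zero_neq_numeral)
  \<comment> \<open>Moving \<open>C'\<close> across gives \<open>inn (C x) (Q (C x)) = 0\<close>;
    with \<open>C' (C x) = 0\<close> the same move for \<open>C\<close> gives
    \<open>C x = 0\<close>.\<close>
  then have "inn (C' (C x)) (C' (C x)) = 0"
    by (simp add: inn(2) CC')
  then have "inn (C x) (C x) = 0"
    by (simp add: inn(1) inn_definite)
  then show ?thesis by (simp add: inn_definite)
qed

end

section \<open>Positivity of \<open>T\<^sup>*T\<close> and the absolute value\<close>

context hilbert_module_pair
begin

lemma adjoint_square_selfadj:
  assumes "is_adjoint innH innK T T'"
  shows "H.selfadj (\<lambda>x. T' (T x))"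
  using assms is_adjoint_swap[OF assms] by (simp add: is_adjoint_def)

text \<open>For \<open>S = T'T\<close>, \<open>P = |S|\<close> and the doubled negative part \<open>N = P - S\<close>, the operator \<open>C = TN\<close>
  satisfies \<open>C'C = N S N = - N P N\<close>, which is minus a square; so \<open>C\<close> and then \<open>N\<close> vanish.\<close>

lemma adjoint_square_norm_pos_if:
  assumes adj: "is_adjoint innH innK T T'"
    and zero: "\<And>C C' E x. is_adjoint innH innK C C' \<Longrightarrow> H.selfadj E \<Longrightarrow>
      (\<And>x. C' (C x) = - E (E x)) \<Longrightarrow> C x = 0"
  obtains t where "H.norm_pos t (\<lambda>x. T' (T x))"
proof -
  define S where "S x = T' (T x)" for x
  have S: "H.selfadj S"
    unfolding S_def by (rule adjoint_square_selfadj[OF adj])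
  interpret S: bounded_linear S by (rule H.selfadj_bounded_linear[OF S])
  interpret T': bounded_linear T'
    by (rule hilbert_module_pair.adjoint_bounded_linear[OF _ is_adjoint_swap[OF adj]]) unfold_locales
  obtain t where SS: "H.norm_pos t (\<lambda>x. S (S x))" by (rule H.norm_pos_square[OF S])
  define P where "P = H.scaled_root t (\<lambda>x. S (S x))"
  have P: "H.norm_pos (sqrt t) P" and PP: "P (P x) = S (S x)" for x
    unfolding P_def using H.norm_pos_scaled_root[OF SS] H.scaled_root_square[OF SS] by auto
  note Ps = H.norm_pos_selfadj[OF P]
  interpret P: bounded_linear P by (rule H.selfadj_bounded_linear[OF Ps])
  have SP: "S (P x) = P (S x)" for x
    unfolding P_def by (rule H.scaled_root_intertwine[OF SS SS S.bounded_linear_axioms]) simp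
  \<comment> \<open>A root of \<open>P\<close> exhibits \<open>N P N\<close> as the square
    \<open>(D N)^2\<close>.\<close>
  define D where "D = H.scaled_root (sqrt t) P"
  have D: "H.selfadj D" and DD: "D (D x) = P x" for x
    unfolding D_def
    using H.norm_pos_selfadj[OF H.norm_pos_scaled_root[OF P]] H.scaled_root_square[OF P] by auto
  define N where "N x = P x - S x" for x
  have N: "H.selfadj N" unfolding N_def by (rule H.selfadj_diff[OF Ps S])
  interpret N: bounded_linear N by (rule H.selfadj_bounded_linear[OF N])
  have ND: "N (D x) = D (N x)" for x
    unfolding D_def by (rule H.scaled_root_intertwine[OF P P N.bounded_linear_axioms])
      (simp add: N_def SP P.diff)
  \<comment> \<open>\<open>S P - S^2 = P S - P^2\<close>, as \<open>P\<close> commutes with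
    \<open>S\<close> and has the same square.\<close>
  have SN: "S (N x) = - P (N x)" for x
    by (simp add: N_def SP S.diff P.diff PP)
  have NSN: "N (S (N x)) = - D (N (D (N x)))" for x
    by (simp add: SN linear_neg[OF N.linear] ND flip: DD)
  have TN: "T (N x) = 0" for x
  proof (rule zero[of "\<lambda>x. T (N x)" "\<lambda>x. N (T' x)" "\<lambda>x. D (N x)"])
    show "is_adjoint innH innK (\<lambda>x. T (N x)) (\<lambda>x. N (T' x))"
      using adj N by (simp add: is_adjoint_def)
    show "H.selfadj (\<lambda>x. D (N x))"
      by (rule H.selfadj_commuting_comp[OF D N ND[symmetric]])
    show "N (T' (T (N x))) = - D (N (D (N x)))" for x
      using NSN by (simp add: S_def)
  qed
  have "N (N x) = 0" for x
  proof -
    have "S (N x) = 0"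
      by (simp add: S_def TN T'.zero)
    then show ?thesis
      using SN[of x] by (simp add: N_def[of "N x"])
  qed
  then have "N x = 0" for x
    by (rule H.selfadj_square_eq_zero[OF N])
  then have "P = (\<lambda>x. T' (T x))"
    by (auto simp: N_def S_def)
  with P that show thesis by blast
qed

end

text \<open>Elements act on this module as adjointable operators by left multiplication, so results
  on operators yield results on the algebra. Definiteness and the norm come from the
  C*-identity.\<close>

lemma cstar_algebra_hilbert_module:
  "hilbert_module (\<lambda>x y. star x * y) ((*) :: 'a::cstar_algebra \<Rightarrow> 'a \<Rightarrow> 'a)"
proof
  fix x :: 'a
  show "star x * x = 0 \<longleftrightarrow> x = 0"
    using cstar_identity[of x] by auto
  show "norm x = sqrt (norm (star x * x))"
    by (simp add: cstar_identity)
qed (auto simp: algebra_simps mult_scaleC_left mult_scaleC_right star_mult star_star cstar_positive_def)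

text \<open>Write \<open>a = star c * c\<close> and \<open>b = star d * d\<close>. Left
  multiplication by \<open>b\<close> has a selfadjoint root \<open>E\<close>, so that by
  \<open>a\<close> is \<open>- E^2\<close>, and the vanishing result on one module applies.\<close>

lemma cstar_positive_sum_zero:
  fixes a b :: "'a::cstar_algebra"
  assumes a: "cstar_positive a" and b: "cstar_positive b" and sum: "a + b = 0"
  shows "a = 0"
proof -
  interpret A: hilbert_module "\<lambda>x y :: 'a. star x * y" "(*)"
    by (rule cstar_algebra_hilbert_module)
  interpret AA: hilbert_module_pair "\<lambda>x y :: 'a. star x * y" "(*)" "\<lambda>x y :: 'a. star x * y" "(*)"
    by (rule A.pair_self)
  obtain c d where c: "a = star c * c" and d: "b = star d * d"
    using a b by (auto simp: cstar_positive_def)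
  have adj: "is_adjoint (\<lambda>x y. star x * y) (\<lambda>x y. star x * y) ((*) u) ((*) (star u))" for u :: 'a
    by (simp add: is_adjoint_def star_mult mult.assoc)
  obtain t where t: "A.norm_pos t (\<lambda>x. star d * (d * x))"
    by (rule AA.adjoint_square_norm_pos_if[OF adj[of d]])
       (rule A.adjoint_square_neg_square_zero, assumption+)
  define E where "E = A.scaled_root t (\<lambda>x. star d * (d * x))"
  have E: "A.selfadj E"
    unfolding E_def by (rule A.norm_pos_selfadj[OF A.norm_pos_scaled_root[OF t]])
  have "star c * (c * x) = - E (E x)" for x
  proof -
    have "star c * (c * x) + star d * (d * x) = (a + b) * x"
      by (simp add: c d algebra_simps)
    then show ?thesis
      by (simp add: sum E_def A.scaled_root_square[OF t] eq_neg_iff_add_eq_0)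
  qed
  \<comment> \<open>Left multiplication by \<open>c\<close> vanishes; evaluating at
    \<open>star c\<close> makes up for a possibly missing unit.\<close>
  then have "c * star c = 0"
    by (rule A.adjoint_square_neg_square_zero[OF adj E])
  then have "star c = 0"
    using cstar_identity[of "star c"] by (simp add: star_star)
  then show ?thesis by (simp add: c)
qed

text \<open>The vanishing hypothesis holds for two modules as well: \<open>innK (C x) (C x)\<close>
  and \<open>innH (E x) (E x)\<close> are positive elements of the algebra with sum zero.\<close>

lemma (in hilbert_module_pair) adjoint_square_norm_pos:
  assumes "is_adjoint innH innK T T'"
  obtains t where "H.norm_pos t (\<lambda>x. T' (T x))"
proof (rule adjoint_square_norm_pos_if[OF assms _ that])
  fix C C' E x
  assume C: "is_adjoint innH innK C C'" and E: "H.selfadj E"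
    and eq: "\<And>x. C' (C x) = - E (E x)"
  have "innK (C x) (C x) + innH (E x) (E x) = 0"
    using C E by (simp add: is_adjoint_def eq H.inn_simps)
  then have "innK (C x) (C x) = 0"
    using cstar_positive_sum_zero K.inn_positive H.inn_positive by blast
  then show "C x = 0"
    by (simp add: K.inn_definite)
qed

section \<open>Positivity, roots and projections as defined, in terms of
  \<open>norm_pos\<close>\<close>

context hilbert_module
begin

lemma adj_selfadj: "selfadj A \<Longrightarrow> adj inn inn A = A"
  by (rule hilbert_module_pair.adj_eqI[OF pair_self])

text \<open>One direction is the positivity of \<open>R* R\<close>; conversely the selfadjoint root
  is a factor.\<close>

lemma positive_operator_iff_norm_pos: "positive_operator inn S \<longleftrightarrow> (\<exists>t. norm_pos t S)"
proof
  assume "positive_operator inn S"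
  then obtain R where R: "R \<in> adjointable inn inn" "S = adj inn inn R \<circ> R"
    by (auto simp: positive_operator_def)
  obtain t where "norm_pos t (\<lambda>x. adj inn inn R (R x))"
    using hilbert_module_pair.adjoint_square_norm_pos[OF pair_self]
      hilbert_module_pair.is_adjoint_adj[OF pair_self R(1)] by blast
  then show "\<exists>t. norm_pos t S"
    by (auto simp: R(2) o_def)
next
  assume "\<exists>t. norm_pos t S"
  then obtain t where t: "norm_pos t S" by blast
  have D: "selfadj (scaled_root t S)"
    by (rule norm_pos_selfadj[OF norm_pos_scaled_root[OF t]])
  then show "positive_operator inn S"
    unfolding positive_operator_def
    by (intro bexI[of _ "scaled_root t S"])
       (auto simp: adj_selfadj scaled_root_square[OF t] adjointable_def)
qed

lemma operator_sqrt_eqI: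
  assumes "norm_pos t R" "R \<circ> R = S"
  shows "operator_sqrt inn S = R"
  unfolding operator_sqrt_def
  using assms norm_pos_square_eq by (intro the_equality) (auto simp: positive_operator_iff_norm_pos)

lemma orth_proj_eqI:
  assumes M: "orth_complemented inn act M" and m: "m \<in> M" "x - m \<in> orth_compl inn M"
  shows "orth_proj inn M x = m"
  unfolding orth_proj_def
proof (rule the_equality)
  fix m' assume m': "m' \<in> M \<and> x - m' \<in> orth_compl inn M"
  then have "m + scaleC (-1) m' \<in> M"
    using M m unfolding orth_complemented_def is_submodule_def by blast
  moreover have "m - m' \<in> orth_compl inn M"
    using m(2) m' by (auto simp: orth_compl_def inn_diff_left)
  ultimately have "m - m' \<in> M \<inter> orth_compl inn M"
    by (simp add: scaleC_minus_one)
  then show "m' = m"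
    using M unfolding orth_complemented_def by simp
qed (use m in simp)

lemma orth_proj:
  assumes "orth_complemented inn act M"
  shows "orth_proj inn M x \<in> M" "x - orth_proj inn M x \<in> orth_compl inn M"
proof -
  have "x \<in> {m + n | m n. m \<in> M \<and> n \<in> orth_compl inn M}"
    using assms by (simp add: orth_complemented_def)
  then obtain m n where "x = m + n" "m \<in> M" "n \<in> orth_compl inn M" by blast
  then show "orth_proj inn M x \<in> M" "x - orth_proj inn M x \<in> orth_compl inn M"
    using orth_proj_eqI[OF assms, of m x] by auto
qed

lemma orth_compl_closure: "orth_compl inn (closure M) = orth_compl inn M"
proof
  show "orth_compl inn M \<subseteq> orth_compl inn (closure M)"
  proof
    fix x assume "x \<in> orth_compl inn M"
    then have "M \<subseteq> {y. inn x y = 0}" by (auto simp: orth_compl_def)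
    moreover have "closed {y. inn x y = 0}"
      by (intro closed_Collect_eq continuous_on_const
        bounded_linear.continuous_on[OF bounded_bilinear.bounded_linear_right[OF bounded_bilinear_inn]]
        continuous_on_id)
    ultimately have "closure M \<subseteq> {y. inn x y = 0}"
      by (rule closure_minimal)
    then show "x \<in> orth_compl inn (closure M)" by (auto simp: orth_compl_def)
  qed
qed (use closure_subset in \<open>fastforce simp: orth_compl_def\<close>)

end

context hilbert_module_pair
begin

text \<open>Ensures that the definite description behind \<open>operator_abs\<close> denotes the
  intended root.\<close>

lemma operator_abs:
  assumes "is_adjoint innH innK T T'"
  obtains t where "H.norm_pos t (operator_abs innH innK T)"
    "\<And>x. operator_abs innH innK T (operator_abs innH innK T x) = T' (T x)"
proof -
  obtain t where t: "H.norm_pos t (\<lambda>x. T' (T x))"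
    by (rule adjoint_square_norm_pos[OF assms])
  note root = H.norm_pos_scaled_root[OF t] and square = H.scaled_root_square[OF t]
  have "operator_abs innH innK T = H.scaled_root t (\<lambda>x. T' (T x))"
    unfolding operator_abs_def adj_eqI[OF assms]
    by (rule H.operator_sqrt_eqI[OF root]) (simp add: fun_eq_iff square)
  with root square that show thesis by simp
qed

lemma orth_compl_range:
  assumes "is_adjoint innH innK T T'"
  shows "orth_compl innK (range T) = null_space T'"
proof -
  have "T' y = 0" if "\<forall>x. innK y (T x) = 0" for y
    using that is_adjoint_swap[OF assms] by (metis H.inn_definite is_adjoint_def)
  moreover have "innK y (T x) = 0" if "T' y = 0" for x y
    using that is_adjoint_swap[OF assms] by (metis H.inn_zero_left is_adjoint_def)
  ultimately show ?thesis
    by (auto simp: orth_compl_def null_space_def)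
qed

end

section \<open>Polar decomposition\<close>

theorem lemma3p6:
  fixes innH :: "'h::complex_banach \<Rightarrow> 'h \<Rightarrow> 'a::cstar_algebra"
    and actH :: "'h \<Rightarrow> 'a \<Rightarrow> 'h"
    and innK :: "'k::complex_banach \<Rightarrow> 'k \<Rightarrow> 'a"
    and actK :: "'k \<Rightarrow> 'a \<Rightarrow> 'k"
    and T U :: "'h \<Rightarrow> 'k"
  defines "Ts \<equiv> adj innH innK T"
    and "Us \<equiv> adj innH innK U"
    and "absT \<equiv> operator_abs innH innK T"
    and "absTs \<equiv> operator_abs innK innH (adj innH innK T)"
  assumes "hilbert_module innH actH"
    and "hilbert_module innK actK"
    and "T \<in> adjointable innH innK"
    and "orth_complemented innH actH (closure (range Ts))"
    and "partial_isometry innH innK U"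
    and "T = U \<circ> absT"
    and "Us \<circ> U = orth_proj innH (closure (range Ts))"
  shows "orth_complemented innK actK (closure (range T))
    \<and> null_space U = null_space T
    \<and> null_space Us = null_space Ts
    \<and> range U = closure (range T)
    \<and> range Us = closure (range Ts)
    \<and> Ts = Us \<circ> absTs
    \<and> U \<circ> Us = orth_proj innK (closure (range T))
    \<and> absTs = U \<circ> absT \<circ> Us
    \<and> U \<circ> absT = absTs \<circ> U"
proof -
  interpret H: hilbert_module innH actH by fact
  interpret K: hilbert_module innK actK by fact
  interpret HK: hilbert_module_pair innH actH innK actK ..
  interpret KH: hilbert_module_pair innK actK innH actH ..
  define M where "M = closure (range Ts)"
  note M = \<open>orth_complemented innH actH (closure (range Ts))\<close>[folded M_def]
  have T: "is_adjoint innH innK T Ts"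
    unfolding Ts_def by (rule HK.is_adjoint_adj) fact
  have U: "is_adjoint innH innK U Us"
    unfolding Us_def using \<open>partial_isometry innH innK U\<close>
    by (intro HK.is_adjoint_adj) (simp add: partial_isometry_def)
  note T' = HK.is_adjoint_swap[OF T] and U' = HK.is_adjoint_swap[OF U]
  interpret U: bounded_linear U by (rule HK.adjoint_bounded_linear[OF U])
  interpret Us: bounded_linear Us by (rule KH.adjoint_bounded_linear[OF U'])
  have innU: "innK (U x) y = innH x (Us y)" "innH (Us y) x = innK y (U x)" for x y
    using U U' by (simp_all add: is_adjoint_def)
  obtain s where P: "H.norm_pos s absT" and PP: "\<And>x. absT (absT x) = Ts (T x)"
    using HK.operator_abs[OF T] unfolding absT_def by blast
  note Ps = H.norm_pos_selfadj[OF P]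
  interpret P: bounded_linear absT by (rule H.selfadj_bounded_linear[OF Ps])
  have T_eq: "T x = U (absT x)" for x
    using fun_cong[OF \<open>T = U \<circ> absT\<close>, of x] by simp
  have UU: "Us (U x) = orth_proj innH M x" for x
    using fun_cong[OF \<open>Us \<circ> U = _\<close>, of x] by (simp add: M_def)
  \<comment> \<open>Adjoint of \<open>T = U |T|\<close>.\<close>
  have Ts_eq: "Ts y = absT (Us y)" for y
  proof -
    have "is_adjoint innH innK T (\<lambda>y. absT (Us y))"
      by (simp add: is_adjoint_def T_eq innU H.selfadjD[OF Ps])
    then show ?thesis using HK.is_adjoint_unique[OF T] by simp
  qed
  have M_perp: "orth_compl innH M = null_space T"
    unfolding M_def by (simp add: H.orth_compl_closure KH.orth_compl_range[OF T'])

  \<comment> \<open>Relations between \<open>U\<close>, \<open>absT\<close> and the initial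
    projection\<close>
  have UU_M: "Us (U m) = m" if "m \<in> M" for m
    unfolding UU
    by (rule H.orth_proj_eqI[OF M that]) (simp add: orth_compl_def)
  have UU_in_M: "Us (U x) \<in> M" and UU_perp: "T (x - Us (U x)) = 0" for x
    using H.orth_proj[OF M, of x] by (simp_all add: UU M_perp[unfolded null_space_def])
  have null_abs: "absT x = 0" if "T x = 0" for x
  proof (rule H.selfadj_square_eq_zero[OF Ps])
    show "absT (absT x) = 0"
      using PP[of x] that Ts_eq[of 0] by (simp add: P.zero Us.zero)
  qed
  have P_UU: "absT (Us (U x)) = absT x" for x
    using null_abs[OF UU_perp[of x]] by (simp add: P.diff)
  \<comment> \<open>Adjoint of \<open>P_UU\<close>, both factors being selfadjoint.\<close>
  have UU_P: "Us (U (absT x)) = absT x" for x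
  proof (rule H.inn_eqI_right)
    show "innH y (Us (U (absT x))) = innH y (absT x)" for y
      by (simp only: innU(1)[symmetric]) (simp only: innU(2)[symmetric] H.selfadjD[OF Ps, symmetric] P_UU)
  qed
  \<comment> \<open>The null space of \<open>T\<close> is the complement of \<open>M\<close>, on
    which \<open>Us (U x) = 0\<close>; then
    \<open>innK (U x) (U x) = innH x (Us (U x)) = 0\<close>.\<close>
  have T_zero: "T x = 0 \<longleftrightarrow> U x = 0" for x
  proof
    assume "T x = 0"
    then have "x \<in> orth_compl innH M"
      by (simp add: M_perp null_space_def)
    moreover have "0 \<in> M"
      using M by (simp add: orth_complemented_def is_submodule_def)
    ultimately have "Us (U x) = 0"
      unfolding UU by (intro H.orth_proj_eqI[OF M]) auto
    then show "U x = 0"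
      using innU(1)[of x "U x"] by (simp add: K.inn_definite)
  next
    assume "U x = 0"
    then show "T x = 0"
      using UU_perp[of x] by (simp add: Us.zero)
  qed
  have UUU: "U (Us (U x)) = U x" for x
    using UU_perp[of x] by (simp add: T_zero U.diff)
  have UUU': "Us (U (Us y)) = Us y" for y
  proof (rule H.inn_eqI_right)
    fix x
    have "innH x (Us (U (Us y))) = innH (Us (U x)) (Us y)"
      by (simp only: innU)
    also have "\<dots> = innH x (Us y)"
      by (simp only: innU(1)[symmetric] UUU)
    finally show "innH x (Us (U (Us y))) = innH x (Us y)" .
  qed

  \<comment> \<open>The absolute value of the adjoint\<close>
  have V: "absTs = (\<lambda>y. U (absT (Us y)))"
  proof -
    \<comment> \<open>With \<open>absT = D^2\<close> the candidate becomes
      \<open>(D Us)* (D Us)\<close>, hence positive.\<close>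
    let ?D = "H.scaled_root s absT"
    have D: "H.selfadj ?D"
      by (rule H.norm_pos_selfadj[OF H.norm_pos_scaled_root[OF P]])
    have "is_adjoint innK innH (\<lambda>y. ?D (Us y)) (\<lambda>x. U (?D x))"
      by (simp add: is_adjoint_def innU H.selfadjD[OF D])
    then obtain r where "K.norm_pos r (\<lambda>y. U (?D (?D (Us y))))"
      by (rule KH.adjoint_square_norm_pos)
    then have "K.norm_pos r (\<lambda>y. U (absT (Us y)))"
      by (simp add: H.scaled_root_square[OF P])
    \<comment> \<open>The inner \<open>Us U\<close> is absorbed by \<open>UU_P\<close>, leaving
      \<open>U absT absT Us = T Ts\<close>.\<close>
    moreover have "(\<lambda>y. U (absT (Us y))) \<circ> (\<lambda>y. U (absT (Us y))) = adj innK innH Ts \<circ> Ts"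
      by (auto simp: KH.adj_eqI[OF T'] UU_P T_eq Ts_eq)
    ultimately show ?thesis
      unfolding absTs_def operator_abs_def Ts_def[symmetric] by (rule K.operator_sqrt_eqI)
  qed

  \<comment> \<open>Ranges of \<open>Us\<close> and \<open>U\<close>\<close>
  have range_Us: "range Us = M"
  proof (intro equalityI subsetI)
    show "x \<in> M" if "x \<in> range Us" for x
      using that UU_in_M UUU' by (metis rangeE)
    show "x \<in> range Us" if "x \<in> M" for x
      using UU_M[OF that] by (metis rangeI)
  qed
  have closed_range_U: "closed (range U)"
  proof -
    \<comment> \<open>As the fixed points of a continuous map, the range is closed.\<close>
    have "range U = {y. U (Us y) = y}"
    proof (intro equalityI subsetI CollectI)
      show "U (Us y) = y" if "y \<in> range U" for y
        using that UUU by auto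
      show "y \<in> range U" if "y \<in> {y. U (Us y) = y}" for y
        using that range_eqI[of y U "Us y"] by simp
    qed
    moreover have "closed {y. U (Us y) = y}"
      by (intro closed_Collect_eq U.continuous_on Us.continuous_on continuous_on_id)
    ultimately show ?thesis by simp
  qed
  have range_U: "range U = closure (range T)"
  proof
    show "closure (range T) \<subseteq> range U"
      by (rule closure_minimal[OF _ closed_range_U]) (auto simp: T_eq)
    have "U ` M \<subseteq> closure (U ` range Ts)"
      unfolding M_def
      by (rule image_closure_subset) (auto intro!: U.continuous_on continuous_on_id simp: closure_subset)
    \<comment> \<open>\<open>U Ts = U absT Us = T Us\<close>.\<close>
    also have "\<dots> \<subseteq> closure (range T)"
      by (rule closure_mono) (auto simp: Ts_eq simp flip: T_eq)
    finally have "U ` M \<subseteq> closure (range T)" .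
    moreover have "U x \<in> U ` M" for x
      using imageI[OF UU_in_M, of U x] by (simp add: UUU)
    ultimately show "range U \<subseteq> closure (range T)"
      by blast
  qed

  \<comment> \<open>Complementation of the range of \<open>U\<close>\<close>
  have perp: "orth_compl innK (range U) = null_space Us"
    by (rule HK.orth_compl_range[OF U])
  have compl: "y - U (Us y) \<in> orth_compl innK (range U)" for y
    by (simp add: perp null_space_def Us.diff UUU')
  have complemented: "orth_complemented innK actK (range U)"
    unfolding orth_complemented_def
  proof (intro conjI closed_range_U)
    show "is_submodule actK (range U)"
      unfolding is_submodule_def
    proof (intro conjI ballI allI)
      show "0 \<in> range U" by (metis U.zero rangeI)
      fix y assume "y \<in> range U"
      then obtain x where x: "y = U x" by blast
      show "scaleC c y \<in> range U" for c
        unfolding x HK.adjoint_scaleC[OF U, symmetric] by (rule rangeI)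
      show "actK y a \<in> range U" for a
        unfolding x HK.adjoint_act[OF U, symmetric] by (rule rangeI)
      show "y + z \<in> range U" if "z \<in> range U" for z
        using that unfolding x by (auto simp flip: U.add)
    qed
    show "{m + n | m n. m \<in> range U \<and> n \<in> orth_compl innK (range U)} = UNIV"
    proof (intro set_eqI iffI UNIV_I CollectI exI conjI)
      show "y = U (Us y) + (y - U (Us y))" for y by simp
    qed (auto intro: compl)
    show "range U \<inter> orth_compl innK (range U) = {0}"
    proof (intro equalityI subsetI)
      show "y \<in> {0}" if "y \<in> range U \<inter> orth_compl innK (range U)" for y
        using that K.inn_definite[of y] unfolding orth_compl_def by blast
      show "y \<in> range U \<inter> orth_compl innK (range U)" if "y \<in> {0}" for y
        using that range_eqI[of 0 U 0] by (simp add: orth_compl_def U.zero)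
    qed
  qed

  show ?thesis
  proof (intro conjI)
    show "orth_complemented innK actK (closure (range T))"
      using complemented by (simp add: range_U)
    show "null_space U = null_space T"
      by (simp add: null_space_def T_zero)
    show "null_space Us = null_space Ts"
      \<comment> \<open>Both null spaces are the orthogonal complement of the range of
        \<open>T\<close>, which passing to the closure does not change.\<close>
      using perp unfolding range_U K.orth_compl_closure HK.orth_compl_range[OF T] by simp
    show "range U = closure (range T)" by (rule range_U)
    show "range Us = closure (range Ts)" using range_Us by (simp add: M_def)
    show "Ts = Us \<circ> absTs" by (auto simp: V Ts_eq UU_P)
    show "U \<circ> Us = orth_proj innK (closure (range T))"
      unfolding range_U[symmetric]
      using K.orth_proj_eqI[OF complemented _ compl] by auto
    show "absTs = U \<circ> absT \<circ> Us" by (auto simp: V)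
    show "U \<circ> absT = absTs \<circ> U" by (auto simp: V P_UU)
  qed
qed

end
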